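(* Let $m \ge n \ge 2$ be integers. For all prime powers $q$ and all integers $2 \le d \le n$ and $1\le k \le mn$ we have $$1-\delta_q(n \times m, k, d) \le \frac{(b_q(n \times m,d-1)-1) \, \binom{mn-1}{k-1}_q}{(q-1) \, \binom{mn}{k}_q},$$ $$\delta_q(n \times m, k, d) \le 1 - \frac{\left(b_q(n \times m,d-1)-1\right)\left(\frac{q^{k}-1}{q^{mn}-1}\right)}{(q-1)+\left(b_q(n \times m, d-1)-q\right)\left(\frac{q^{k-1}-1}{q^{mn-1}-1}\right)}.$$ In particular, as $q \to +\infty$, $$1- \delta_q(n \times m, k,d) \in O\left(q^{(d-1)(m+n-d+1)-(mn-k)-1}\right),$$ $$\delta_q(n \times m, k,d) \in O\left(q^{-(d-1)(m+n-d+1)+(mn-k)+1}\right).$$ Therefore, $$\lim_{q \to + \infty} \delta_q(n \times m,k,d) = \begin{cases} 1 & \text{if } (d-1)(m+n-d+1)\le mn-k, \\ 0 & \text{if } (d-1)(m+n-d+1) \ge mn-k+2. \end{cases}$$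
   Context: Limits and $O$-estimates as $q\to+\infty$ are over the prime powers $q$, with $m,n,d,k$ fixed. $\binom{a}{b}_q = \prod_{i=0}^{b-1} \frac{q^a-q^i}{q^b-q^i}$ is the $q$-binomial coefficient. $b_q(n\times m,r)$ denotes the number of matrices in $\mathbb{F}_q^{n\times m}$ of rank at most $r$, i.e. $b_q(n\times m,r)=\sum_{i=0}^r\binom{n}{i}_q \prod_{j=0}^{i-1}(q^m-q^j)$. A (rank-metric) code is a non-zero $\mathbb{F}_q$-linear subspace $\mathcal{C}\le\mathbb{F}_q^{n\times m}$; its minimum distance is $d(\mathcal{C})=\min\{\mathrm{rk}(M) \mid M \in \mathcal{C}, M\ne 0\}$. For $1\le k\le mn$ and $1 \le d \le n$, $$\delta_q(n \times m, k, d):= \frac{|\{\mathcal{C} \le \mathbb{F}_q^{n\times m} \mid \dim(\mathcal{C})=k, \; d(\mathcal{C}) \ge d\}|}{\binom{mn}{k}_q}.$$ *)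

theory Defs
  imports
    "HOL-Library.Landau_Symbols"
    "HOL-Number_Theory.Prime_Powers"
    "Jordan_Normal_Form.Missing_VectorSpace"
begin

text \<open>The field with \<open>q\<close> elements is a parameter \<open>F\<close>, a field in the sense of \<^locale>\<open>field\<close>
  whose carrier has \<open>q\<close> elements. An \<open>n \<times> m\<close> matrix over \<open>F\<close> is an extensional function on
  \<open>{..<n} \<times> {..<m}\<close> with values in \<open>carrier F\<close>.\<close>

definition mat_space ::
  "('a, 'b) ring_scheme \<Rightarrow> nat \<Rightarrow> nat \<Rightarrow> ('a, nat \<times> nat \<Rightarrow> 'a) module" where
  "mat_space F n m = ring.func_space F ({..<n} \<times> {..<m})"

definition col_space :: "('a, 'b) ring_scheme \<Rightarrow> nat \<Rightarrow> ('a, nat \<Rightarrow> 'a) module" where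
  "col_space F n = ring.func_space F {..<n}"

definition subspace_dim ::
  "('a, 'b) ring_scheme \<Rightarrow> ('a, 'c, 'd) module_scheme \<Rightarrow> 'c set \<Rightarrow> nat" where
  "subspace_dim F V W = vectorspace.dim F (V\<lparr>carrier := W\<rparr>)"

definition mat_col :: "nat \<Rightarrow> (nat \<times> nat \<Rightarrow> 'a) \<Rightarrow> nat \<Rightarrow> nat \<Rightarrow> 'a" where
  "mat_col n M j = (\<lambda>i\<in>{..<n}. M (i, j))"

definition mat_rank ::
  "('a, 'b) ring_scheme \<Rightarrow> nat \<Rightarrow> nat \<Rightarrow> (nat \<times> nat \<Rightarrow> 'a) \<Rightarrow> nat" where
  "mat_rank F n m M =
     subspace_dim F (col_space F n) (module.span F (col_space F n) (mat_col n M ` {..<m}))"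

definition num_rank_le :: "('a, 'b) ring_scheme \<Rightarrow> nat \<Rightarrow> nat \<Rightarrow> nat \<Rightarrow> nat" where
  "num_rank_le F n m r = card {M \<in> carrier (mat_space F n m). mat_rank F n m M \<le> r}"

definition rank_metric_code ::
  "('a, 'b) ring_scheme \<Rightarrow> nat \<Rightarrow> nat \<Rightarrow> (nat \<times> nat \<Rightarrow> 'a) set \<Rightarrow> bool" where
  "rank_metric_code F n m C \<longleftrightarrow>
     subspace F C (mat_space F n m) \<and> C \<noteq> {\<zero>\<^bsub>mat_space F n m\<^esub>}"

definition min_distance ::
  "('a, 'b) ring_scheme \<Rightarrow> nat \<Rightarrow> nat \<Rightarrow> (nat \<times> nat \<Rightarrow> 'a) set \<Rightarrow> nat" where
  "min_distance F n m C = Min {mat_rank F n m M | M. M \<in> C \<and> M \<noteq> \<zero>\<^bsub>mat_space F n m\<^esub>}"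

definition q_binomial :: "nat \<Rightarrow> nat \<Rightarrow> nat \<Rightarrow> real" where
  "q_binomial q a b = (\<Prod>i<b. (real q ^ a - real q ^ i) / (real q ^ b - real q ^ i))"

definition code_density :: "('a, 'b) ring_scheme \<Rightarrow> nat \<Rightarrow> nat \<Rightarrow> nat \<Rightarrow> nat \<Rightarrow> real" where
  "code_density F n m k d =
     real (card {C. rank_metric_code F n m C \<and> subspace_dim F (mat_space F n m) C = k
                  \<and> d \<le> min_distance F n m C})
     / q_binomial (card (carrier F)) (m * n) k"

definition prime_powers_at_top :: "nat filter" where
  "prime_powers_at_top = inf at_top (principal {q. primepow q})"

end

theory Submission
  imports "HOL-Analysis.Convex" Defs
begin

text \<open>
  A code has minimum distance at least \<open>d\<close> iff it avoids the set \<open>B\<close> of nonzero matrices of rank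
  at most \<open>r = d - 1\<close>. So \<open>1 - \<delta>\<close> is the probability that a random \<open>k\<close>-dimensional subspace \<open>C\<close>
  of an \<open>N\<close>-dimensional space, \<open>N = mn\<close>, meets \<open>B\<close>, and both bounds come from the first two
  moments of the random variable \<open>X C = |C \<inter> B|\<close>.

  All that is used about \<open>B\<close> is that it is closed under nonzero scalars. Let \<open>N\<^sub>l\<close> be the
  number of \<open>k\<close>-dimensional subspaces containing \<open>l\<close> given independent vectors; counting the
  ways to extend these vectors to a basis of such a subspace gives
  \<open>N\<^sub>l = (\<Prod>i\<in>{l..<k}. (q^N - q^i) / (q^k - q^i))\<close> for \<open>l \<le> k\<close> (\<open>card_subspaces_above\<close>),
  while \<open>N\<^sub>2 = 0\<close> for \<open>k = 1\<close>. Hence \<open>X\<close> sums to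
  \<open>|B| N\<^sub>1\<close>, and \<open>X\<^sup>2\<close> sums to \<open>|B| ((q - 1) N\<^sub>1 + (|B| - (q - 1)) N\<^sub>2)\<close>, because exactly \<open>q - 1\<close>
  elements of \<open>B\<close> are proportional to a given one.
  A subspace that meets \<open>B\<close> does so in at least \<open>q - 1\<close> vectors, which bounds the number of
  such subspaces from above (\<open>card_meeting_le\<close>). The Cauchy-Schwarz inequality bounds it from
  below (\<open>card_meeting_ge\<close>). Dividing by the number of all \<open>k\<close>-dimensional subspaces yields the two
  inequalities for \<open>\<delta>\<close>.

  For the asymptotics it suffices to know that the number \<open>b\<close> of matrices of rank at most \<open>r\<close> is
  \<open>q^(r (n + m - r))\<close> up to constants. A matrix of rank at most \<open>r\<close> is determined by a set \<open>J\<close> of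
  \<open>r\<close> column indices whose columns span the column space, by these \<open>r\<close> columns, and by the
  position of each of the other \<open>m - r\<close> columns in a space of at most \<open>q^r\<close> vectors; this gives
  the upper bound. Letting the first \<open>r\<close> columns be independent and the others arbitrary in their
  span gives the lower bound. Finally the second-moment bound implies
  \<open>\<delta> (b - 1) \<rho> \<le> q - 1\<close> with \<open>\<rho> = (q^(k-1) - 1) / (q^(N-1) - 1)\<close>.
\<close>

section \<open>Vector spaces with finitely many vectors\<close>

text \<open>A vector space with finitely many vectors over a finite field, whose order is \<open>q\<close> below.\<close>

locale finite_vectorspace = vectorspace K V for K V +
  assumes finite_scalars: "finite (carrier K)"
    and finite_vectors: "finite (carrier V)"
begin

abbreviation q :: nat where "q \<equiv> card (carrier K)"

lemma card_scalars_ge_2: "2 \<le> q"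
proof -
  have "card {\<zero>\<^bsub>K\<^esub>, \<one>\<^bsub>K\<^esub>} \<le> q"
    by (rule card_mono[OF finite_scalars]) auto
  then show ?thesis by simp
qed

lemma finite_subspace: "subspace K W V \<Longrightarrow> finite W"
  using finite_vectors finite_subset submodule.subset[OF is_module] by metis

lemma subspace_subset: "subspace K W V \<Longrightarrow> W \<subseteq> carrier V"
  using submodule.subset[OF is_module] by metis

lemma span_subset_subspace: "subspace K W V \<Longrightarrow> S \<subseteq> W \<Longrightarrow> span S \<subseteq> W"
  by (rule span_is_subset) simp_all

lemma span_subset_span: "T \<subseteq> carrier V \<Longrightarrow> S \<subseteq> span T \<Longrightarrow> span S \<subseteq> span T"
  by (rule span_subset_subspace[OF span_is_subspace])

lemma finite_span_vectors: "S \<subseteq> carrier V \<Longrightarrow> finite (span S)"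
  by (rule finite_subspace[OF span_is_subspace])

lemma span_eq_lincomb_image:
  assumes S: "S \<subseteq> carrier V"
  shows "span S = (\<lambda>a. lincomb a S) ` (S \<rightarrow>\<^sub>E carrier K)"
proof -
  have fin: "finite S" using S finite_vectors finite_subset by blast
  have "lincomb a S \<in> (\<lambda>a. lincomb a S) ` (S \<rightarrow>\<^sub>E carrier K)" if "a \<in> S \<rightarrow> carrier K" for a
  proof
    show "restrict a S \<in> S \<rightarrow>\<^sub>E carrier K" using that by auto
    show "lincomb a S = lincomb (restrict a S) S"
      by (rule lincomb_restrict[OF S that]) simp
  qed
  then show ?thesis
    unfolding finite_span[OF fin S] by (auto simp: PiE_iff)
qed

lemma card_span_le:
  assumes S: "S \<subseteq> carrier V"
  shows "card (span S) \<le> q ^ card S"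
proof -
  have fin: "finite S" using S finite_vectors finite_subset by blast
  have "card (span S) \<le> card (S \<rightarrow>\<^sub>E carrier K)"
    unfolding span_eq_lincomb_image[OF S]
    by (rule card_image_le) (simp add: fin finite_scalars finite_PiE)
  also have "\<dots> = q ^ card S" by (simp add: card_PiE fin)
  finally show ?thesis .
qed

lemma card_span:
  assumes S: "S \<subseteq> carrier V" and li: "lin_indpt S"
  shows "card (span S) = q ^ card S"
proof -
  have fin: "finite S" using S finite_vectors finite_subset by blast
  have "inj_on (\<lambda>a. lincomb a S) (S \<rightarrow>\<^sub>E carrier K)"
  proof (rule inj_onI)
    fix a b
    assume a: "a \<in> S \<rightarrow>\<^sub>E carrier K" and b: "b \<in> S \<rightarrow>\<^sub>E carrier K"
      and eq: "lincomb a S = lincomb b S"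
    have a': "a \<in> S \<rightarrow> carrier K" and b': "b \<in> S \<rightarrow> carrier K" using a b by auto
    have "lincomb (\<lambda>v. a v \<ominus>\<^bsub>K\<^esub> b v) S = lincomb a S \<ominus>\<^bsub>V\<^esub> lincomb b S"
      by (rule lincomb_diff[OF fin S a' b'])
    also have "\<dots> = \<zero>\<^bsub>V\<^esub>"
      using lincomb_closed[OF S b'] by (simp add: eq M.minus_eq M.r_neg)
    finally have z: "lincomb (\<lambda>v. a v \<ominus>\<^bsub>K\<^esub> b v) S = \<zero>\<^bsub>V\<^esub>" .
    have "(\<lambda>v. a v \<ominus>\<^bsub>K\<^esub> b v) \<in> S \<rightarrow> {\<zero>\<^bsub>K\<^esub>}"
      by (rule not_lindepD[OF li fin _ _ z]) (use a' b' in auto)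
    then have "a v = b v" if "v \<in> S" for v
      using that a' b' R.minus_other_side[of "a v" "b v"] R.zero_closed by (auto simp: Pi_iff)
    then show "a = b" using a b by (meson PiE_ext)
  qed
  then have "card (span S) = card (S \<rightarrow>\<^sub>E carrier K)"
    unfolding span_eq_lincomb_image[OF S] by (rule card_image)
  also have "\<dots> = q ^ card S" by (simp add: card_PiE fin)
  finally show ?thesis .
qed

lemma card_eq_power_dim: "card (carrier V) = q ^ dim"
proof -
  have "span (carrier V) = carrier V"
    using in_own_span[of "carrier V"] span_is_subset2[of "carrier V"] by blast
  then have "fin_dim" unfolding fin_dim_def using finite_vectors by blast
  then obtain S where S: "finite S" "basis S" using finite_basis_exists by blast
  then have "span S = carrier V" "lin_indpt S" "S \<subseteq> carrier V" by (auto simp: basis_def)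
  with card_span[of S] dim_basis[OF S] show ?thesis by simp
qed

lemma subspace_finite_vectorspace:
  assumes "subspace K W V" shows "finite_vectorspace K (vs W)"
  using subspace_is_vs[OF assms] finite_subspace[OF assms] finite_scalars
  by (simp add: finite_vectorspace_def finite_vectorspace_axioms_def)

lemma card_subspace:
  assumes "subspace K W V" shows "card W = q ^ vectorspace.dim K (vs W)"
  using finite_vectorspace.card_eq_power_dim[OF subspace_finite_vectorspace[OF assms]] by simp

lemma dim_eq_iff_card:
  assumes "subspace K W V" shows "vectorspace.dim K (vs W) = k \<longleftrightarrow> card W = q ^ k"
  using card_subspace[OF assms] card_scalars_ge_2 by simp

lemma dim_le_iff_card:
  assumes "subspace K W V" shows "vectorspace.dim K (vs W) \<le> k \<longleftrightarrow> card W \<le> q ^ k"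
  using card_subspace[OF assms] card_scalars_ge_2 by simp

lemma lin_indpt_empty: "lin_indpt {}"
  by (simp add: lin_dep_def)

lemma lin_indpt_insert_iff:
  assumes "S \<subseteq> carrier V" "v \<in> carrier V" "v \<notin> S"
  shows "lin_indpt (insert v S) \<longleftrightarrow> lin_indpt S \<and> v \<notin> span S"
  using lin_dep_iff_in_span[OF assms(1) _ assms(2,3)] subset_li_is_li[of "insert v S" S] by auto

text \<open>The lists of \<open>j\<close> vectors of \<open>W\<close> which, put in front of the list \<open>us\<close>, give a list of
  linearly independent vectors. Independence is a property of sets here, so distinctness of the
  entries is required separately.\<close>

definition indep_extensions :: "'c set \<Rightarrow> 'c list \<Rightarrow> nat \<Rightarrow> 'c list set" where
  "indep_extensions W us j =
     {xs. length xs = j \<and> set xs \<subseteq> W \<and> distinct (xs @ us) \<and> lin_indpt (set (xs @ us))}"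

lemma finite_indep_extensions: "finite W \<Longrightarrow> finite (indep_extensions W us j)"
  unfolding indep_extensions_def
  by (rule finite_subset[OF _ finite_lists_length_eq[of W j]]) auto

lemma card_span_append:
  assumes "set us \<subseteq> W" "W \<subseteq> carrier V" "xs \<in> indep_extensions W us j"
  shows "card (span (set (xs @ us))) = q ^ (length us + j)"
proof -
  have "card (span (set (xs @ us))) = q ^ card (set (xs @ us))"
    using assms by (intro card_span) (auto simp: indep_extensions_def)
  also have "card (set (xs @ us)) = length us + j"
    using assms(3) distinct_card[of "xs @ us"] by (simp add: indep_extensions_def)
  finally show ?thesis .
qed

text \<open>A further vector may be any element of \<open>W\<close> outside the span of the vectors chosen so far.
  The truncated subtraction is harmless: if \<open>length us + i\<close> exceeds \<open>w\<close> for some \<open>i < j\<close>, then both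
  sides vanish.\<close>

lemma card_indep_extensions:
  assumes W: "subspace K W V" and cW: "card W = q ^ w"
    and us: "set us \<subseteq> W" "distinct us" "lin_indpt (set us)"
  shows "card (indep_extensions W us j) = (\<Prod>i<j. q ^ w - q ^ (length us + i))"
proof (induction j)
  case 0
  have "indep_extensions W us 0 = {[]}"
    using us by (auto simp: indep_extensions_def)
  then show ?case by simp
next
  case (Suc j)
  have WV: "W \<subseteq> carrier V" by (rule subspace_subset[OF W])
  have step: "v # xs \<in> indep_extensions W us (Suc j) \<longleftrightarrow>
      xs \<in> indep_extensions W us j \<and> v \<in> W - span (set (xs @ us))" for v xs
  proof (cases "set xs \<subseteq> W \<and> v \<in> W")
    case True
    then have "set (xs @ us) \<subseteq> carrier V" "v \<in> carrier V" using us WV by auto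
    with lin_indpt_insert_iff[OF this] in_own_span[OF this(1)] True show ?thesis
      unfolding indep_extensions_def by auto
  qed (auto simp: indep_extensions_def)
  have "bij_betw (\<lambda>(xs, v). v # xs)
      (SIGMA xs : indep_extensions W us j. W - span (set (xs @ us)))
      (indep_extensions W us (Suc j))"
  proof (rule bij_betw_imageI)
    show "inj_on (\<lambda>(xs, v). v # xs) (SIGMA xs : indep_extensions W us j. W - span (set (xs @ us)))"
      by (auto simp: inj_on_def)
    have "xs \<in> (\<lambda>(xs, v). v # xs) ` (SIGMA xs : indep_extensions W us j. W - span (set (xs @ us)))"
      if "xs \<in> indep_extensions W us (Suc j)" for xs
    proof (cases xs)
      case Nil
      then show ?thesis using that by (simp add: indep_extensions_def)
    next
      case (Cons v ws)
      then show ?thesis using that step[of v ws] by force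
    qed
    then show "(\<lambda>(xs, v). v # xs) ` (SIGMA xs : indep_extensions W us j. W - span (set (xs @ us)))
        = indep_extensions W us (Suc j)"
      using step by auto
  qed
  then have "card (indep_extensions W us (Suc j))
      = card (SIGMA xs : indep_extensions W us j. W - span (set (xs @ us)))"
    by (simp add: bij_betw_same_card)
  also have "\<dots> = (\<Sum>xs\<in>indep_extensions W us j. card (W - span (set (xs @ us))))"
    using finite_indep_extensions finite_subspace[OF W] by (simp add: card_SigmaI)
  also have "\<dots> = (\<Sum>xs\<in>indep_extensions W us j. q ^ w - q ^ (length us + j))"
  proof (rule sum.cong[OF refl])
    fix xs assume xs: "xs \<in> indep_extensions W us j"
    have sub: "span (set (xs @ us)) \<subseteq> W"
      using xs us by (intro span_subset_subspace[OF W]) (auto simp: indep_extensions_def)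
    then show "card (W - span (set (xs @ us))) = q ^ w - q ^ (length us + j)"
      using card_span_append[OF us(1) WV xs] cW finite_subset[OF sub finite_subspace[OF W]]
      by (simp add: card_Diff_subset)
  qed
  finally show ?case using Suc by (simp add: mult.commute)
qed

text \<open>The \<open>k\<close>-dimensional subspaces that contain \<open>U\<close>; the dimension is expressed through the
  cardinality.\<close>

definition subspaces_above :: "nat \<Rightarrow> 'c set \<Rightarrow> 'c set set" where
  "subspaces_above k U = {C. subspace K C V \<and> card C = q ^ k \<and> U \<subseteq> C}"

lemma finite_subspaces_above: "finite (subspaces_above k U)"
  unfolding subspaces_above_def
  by (rule finite_subset[OF _ finite_Pow_iff[THEN iffD2, OF finite_vectors]])
    (use subspace_subset in auto)

text \<open>Double counting: the ways to extend \<open>us\<close> to \<open>k\<close> independent vectors of the whole space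
  are sorted by the subspace that the \<open>k\<close> vectors span.\<close>

lemma prod_card_subspaces_above:
  assumes us: "set us \<subseteq> carrier V" "distinct us" "lin_indpt (set us)"
    and k: "length us \<le> k" and D: "card (carrier V) = q ^ D"
  shows "(\<Prod>i<k - length us. q ^ D - q ^ (length us + i))
    = card (subspaces_above k (set us)) * (\<Prod>i<k - length us. q ^ k - q ^ (length us + i))"
proof -
  let ?j = "k - length us"
  have V: "subspace K (carrier V) V"
    using vectorspace_axioms module_axioms
    by (auto simp: subspace_def submodule_def)
  have span_eq: "span (set (xs @ us)) = C"
    if "C \<in> subspaces_above k (set us)" "xs \<in> indep_extensions C us ?j" for C xs
  proof (rule card_subset_eq)
    have C: "subspace K C V" "card C = q ^ k" "set us \<subseteq> C"
      using that(1) by (auto simp: subspaces_above_def)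
    show "finite C" by (rule finite_subspace[OF C(1)])
    show "span (set (xs @ us)) \<subseteq> C"
      using that C by (intro span_subset_subspace[OF C(1)]) (auto simp: indep_extensions_def)
    show "card (span (set (xs @ us))) = card C"
      using card_span_append[OF C(3) subspace_subset[OF C(1)] that(2)] C(2) k by simp
  qed
  have "indep_extensions (carrier V) us ?j
      = (\<Union>C\<in>subspaces_above k (set us). indep_extensions C us ?j)"
  proof (intro equalityI subsetI)
    fix xs assume xs: "xs \<in> indep_extensions (carrier V) us ?j"
    then have sub: "set (xs @ us) \<subseteq> carrier V" using us by (auto simp: indep_extensions_def)
    let ?C = "span (set (xs @ us))"
    have "set (xs @ us) \<subseteq> ?C" by (rule in_own_span[OF sub])
    moreover have "card ?C = q ^ k" using card_span_append[OF us(1) subset_refl xs] k by simp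
    ultimately have "?C \<in> subspaces_above k (set us)" "xs \<in> indep_extensions ?C us ?j"
      using span_is_subspace[OF sub] xs by (auto simp: subspaces_above_def indep_extensions_def)
    then show "xs \<in> (\<Union>C\<in>subspaces_above k (set us). indep_extensions C us ?j)" by blast
  next
    fix xs assume "xs \<in> (\<Union>C\<in>subspaces_above k (set us). indep_extensions C us ?j)"
    then show "xs \<in> indep_extensions (carrier V) us ?j"
      using subspace_subset by (fastforce simp: subspaces_above_def indep_extensions_def)
  qed
  then have "card (indep_extensions (carrier V) us ?j)
      = (\<Sum>C\<in>subspaces_above k (set us). card (indep_extensions C us ?j))"
  proof (simp only:, intro card_UN_disjoint ballI impI)
    show "finite (subspaces_above k (set us))" by (rule finite_subspaces_above)
    fix C assume C: "C \<in> subspaces_above k (set us)"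
    then show "finite (indep_extensions C us ?j)"
      by (intro finite_indep_extensions finite_subspace) (auto simp: subspaces_above_def)
    fix C' assume C': "C' \<in> subspaces_above k (set us)" and "C \<noteq> C'"
    then show "indep_extensions C us ?j \<inter> indep_extensions C' us ?j = {}"
      using span_eq[OF C] span_eq[OF C'] by blast
  qed
  also have "\<dots> = (\<Sum>C\<in>subspaces_above k (set us). \<Prod>i<?j. q ^ k - q ^ (length us + i))"
    using us by (intro sum.cong refl card_indep_extensions) (auto simp: subspaces_above_def)
  finally show ?thesis
    using card_indep_extensions[OF V D us] by simp
qed

end

section \<open>Gaussian binomial coefficients\<close>

text \<open>In an \<open>N\<close>-dimensional space over the field with \<open>q\<close> elements, the number of
  \<open>k\<close>-dimensional subspaces that contain a given \<open>l\<close>-dimensional one, for \<open>l \<le> k \<le> N\<close>.\<close>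

definition gauss_from :: "nat \<Rightarrow> nat \<Rightarrow> nat \<Rightarrow> nat \<Rightarrow> real" where
  "gauss_from q N k l = (\<Prod>i\<in>{l..<k}. (real q ^ N - real q ^ i) / (real q ^ k - real q ^ i))"

lemma gauss_from_0: "gauss_from q N k 0 = q_binomial q N k"
  by (simp add: gauss_from_def q_binomial_def lessThan_atLeast0)

lemma gauss_from_step:
  assumes "l < k"
  shows "gauss_from q N k l
    = (real q ^ N - real q ^ l) / (real q ^ k - real q ^ l) * gauss_from q N k (Suc l)"
  using assms by (simp add: gauss_from_def prod.atLeast_Suc_lessThan)

lemma gauss_from_pos:
  assumes "2 \<le> q" "k \<le> N"
  shows "0 < gauss_from q N k l"
  unfolding gauss_from_def
proof (rule prod_pos)
  fix i assume "i \<in> {l..<k}"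
  then have "real q ^ i < real q ^ k" "real q ^ i < real q ^ N"
    using assms by (auto intro!: power_strict_increasing)
  then show "0 < (real q ^ N - real q ^ i) / (real q ^ k - real q ^ i)" by simp
qed

lemma gauss_from_Suc_0:
  assumes q: "2 \<le> q" and k: "1 \<le> k" "k \<le> N"
  shows "gauss_from q N k 1 = q_binomial q N k * ((real q ^ k - 1) / (real q ^ N - 1))"
proof -
  have "1 < real q ^ k" "1 < real q ^ N" using q k by (auto intro!: one_less_power)
  then show ?thesis
    using gauss_from_step[of 0 k q N] k by (simp add: gauss_from_0)
qed

lemma q_binomial_pred:
  assumes q: "2 \<le> q" and k: "1 \<le> k" "k \<le> N"
  shows "q_binomial q (N - 1) (k - 1) = gauss_from q N k 1"
proof -
  obtain k' N' where kN: "k = Suc k'" "N = Suc N'" using k by (metis Suc_le_D One_nat_def le_trans)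
  have q0: "real q \<noteq> 0" using q by simp
  have "gauss_from q N k 1 = (\<Prod>i<k'. (real q ^ N - real q ^ Suc i) / (real q ^ k - real q ^ Suc i))"
    unfolding gauss_from_def kN One_nat_def
    by (subst prod.shift_bounds_Suc_ivl) (simp add: lessThan_atLeast0)
  also have "\<dots> = q_binomial q (N - 1) (k - 1)"
    unfolding q_binomial_def kN using q0
    by (simp flip: right_diff_distrib)
  finally show ?thesis by simp
qed

context finite_vectorspace
begin

lemma card_subspaces_above:
  assumes us: "set us \<subseteq> carrier V" "distinct us" "lin_indpt (set us)"
    and k: "length us \<le> k" "k \<le> N" and N: "card (carrier V) = q ^ N"
  shows "real (card (subspaces_above k (set us))) = gauss_from q N k (length us)"
proof -
  let ?l = "length us"
  have conv: "real (\<Prod>i<k - ?l. q ^ M - q ^ (?l + i)) = (\<Prod>i\<in>{?l..<k}. real q ^ M - real q ^ i)"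
    if "k \<le> M" for M
  proof -
    have "real (\<Prod>i<k - ?l. q ^ M - q ^ (?l + i)) = (\<Prod>i<k - ?l. real q ^ M - real q ^ (?l + i))"
      unfolding of_nat_prod
    proof (rule prod.cong[OF refl])
      fix i assume "i \<in> {..<k - ?l}"
      then have "q ^ (?l + i) \<le> q ^ M"
        using that card_scalars_ge_2 by (intro power_increasing) auto
      then show "real (q ^ M - q ^ (?l + i)) = real q ^ M - real q ^ (?l + i)"
        by (simp add: of_nat_diff)
    qed
    also have "\<dots> = (\<Prod>i\<in>{?l..<k}. real q ^ M - real q ^ i)"
      by (rule prod.reindex_bij_witness[of _ "\<lambda>i. i - ?l" "\<lambda>i. ?l + i"]) auto
    finally show ?thesis .
  qed
  have "(\<Prod>i\<in>{?l..<k}. real q ^ k - real q ^ i) \<noteq> 0"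
    using card_scalars_ge_2 by (auto simp: power_inject_exp)
  moreover have "(\<Prod>i\<in>{?l..<k}. real q ^ N - real q ^ i)
      = real (card (subspaces_above k (set us))) * (\<Prod>i\<in>{?l..<k}. real q ^ k - real q ^ i)"
    using arg_cong[OF prod_card_subspaces_above[OF us k(1) N], of real]
    by (simp only: of_nat_mult conv[OF order_refl] conv[OF k(2)])
  ultimately show ?thesis
    by (simp add: gauss_from_def prod_dividef)
qed

lemma subspaces_above_filter: "subspaces_above k {} \<inter> {C. U \<subseteq> C} = subspaces_above k U"
  by (auto simp: subspaces_above_def)

lemma lin_indpt_singleton:
  assumes "v \<in> carrier V" "v \<noteq> \<zero>\<^bsub>V\<^esub>" shows "lin_indpt {v}"
  using lin_indpt_insert_iff[of "{}" v] assms by (simp add: lin_indpt_empty span_empty)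

lemma card_subspaces_above_empty:
  assumes "k \<le> N" "card (carrier V) = q ^ N"
  shows "real (card (subspaces_above k {})) = q_binomial q N k"
  using card_subspaces_above[of "[]" k N] assms by (simp add: lin_indpt_empty gauss_from_0)

lemma card_subspaces_above_singleton:
  assumes "v \<in> carrier V" "v \<noteq> \<zero>\<^bsub>V\<^esub>" "1 \<le> k" "k \<le> N" "card (carrier V) = q ^ N"
  shows "real (card (subspaces_above k {v})) = gauss_from q N k 1"
  using card_subspaces_above[of "[v]" k N] assms by (simp add: lin_indpt_singleton)

text \<open>The formula includes the case \<open>k = 1\<close>, where no subspace contains two independent vectors
  and the right-hand side is zero.\<close>

lemma card_subspaces_above_pair:
  assumes u: "u \<in> carrier V" "u \<noteq> \<zero>\<^bsub>V\<^esub>" and v: "v \<in> carrier V" "v \<notin> span {u}"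
    and k: "1 \<le> k" "k \<le> N" and N: "card (carrier V) = q ^ N"
  shows "real (card (subspaces_above k {u, v}))
    = gauss_from q N k 1 * ((real q ^ (k - 1) - 1) / (real q ^ (N - 1) - 1))"
proof -
  have q: "2 \<le> q" by (rule card_scalars_ge_2)
  have uv: "v \<noteq> u" using v(2) span_self[OF u(1)] by auto
  have li: "lin_indpt {v, u}"
    using lin_indpt_insert_iff[of "{u}" v] u v uv lin_indpt_singleton[OF u] by simp
  show ?thesis
  proof (cases "k = 1")
    case True
    have "subspaces_above k {u, v} = {}"
    proof (rule equals0I)
      fix C assume C: "C \<in> subspaces_above k {u, v}"
      then have W: "subspace K C V" "card C = q ^ k" "{v, u} \<subseteq> C"
        by (auto simp: subspaces_above_def)
      have "card (span {v, u}) \<le> card C"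
        using span_subset_subspace[OF W(1,3)] finite_subspace[OF W(1)] by (rule card_mono[rotated])
      moreover have "card (span {v, u}) = q ^ 2"
        using card_span[OF _ li] u v uv by (simp add: power2_eq_square)
      ultimately have "q ^ 2 \<le> q ^ 1" using W(2) True by simp
      then show False using q by (simp add: power2_eq_square)
    qed
    then show ?thesis using True by simp
  next
    case False
    then have k2: "1 < k" "2 \<le> N" using k by auto
    then have "1 < real q ^ (k - 1)" "1 < real q ^ (N - 1)"
      using q by (auto intro!: one_less_power)
    moreover have "real q ^ k - real q = real q * (real q ^ (k - 1) - 1)"
      "real q ^ N - real q = real q * (real q ^ (N - 1) - 1)"
      using k2 by (simp_all add: algebra_simps flip: power_Suc)
    moreover have "real (card (subspaces_above k {u, v})) = gauss_from q N k 2"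
      using card_subspaces_above[of "[v, u]" k N] u v uv li k2 k N
      by (simp add: insert_commute numeral_2_eq_2)
    ultimately show ?thesis
      using gauss_from_step[OF k2(1), of q N] q by (simp add: numeral_2_eq_2)
  qed
qed

end

section \<open>Moments of the intersection with a set closed under scalars\<close>

text \<open>A set \<open>B\<close> of nonzero vectors closed under multiplication by nonzero scalars, that is, a
  union of punctured lines, together with a dimension \<open>k\<close> for random subspaces of the
  \<open>N\<close>-dimensional space \<open>V\<close>.\<close>

locale scaling_closed_set = finite_vectorspace K V for K V +
  fixes B :: "'c set" and k N :: nat
  assumes B_subset: "B \<subseteq> carrier V - {\<zero>\<^bsub>V\<^esub>}"
    and B_smult: "\<lbrakk>a \<in> carrier K; a \<noteq> \<zero>\<^bsub>K\<^esub>; v \<in> B\<rbrakk> \<Longrightarrow> a \<odot>\<^bsub>V\<^esub> v \<in> B"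
    and k: "1 \<le> k" "k \<le> N" and card_V: "card (carrier V) = q ^ N"
begin

text \<open>The number of \<open>k\<close>-dimensional subspaces through a given nonzero vector, and the proportion
  of them that contain another given vector, independent of the first.\<close>

abbreviation N1 :: real where "N1 \<equiv> gauss_from q N k 1"
abbreviation \<rho> :: real where "\<rho> \<equiv> (real q ^ (k - 1) - 1) / (real q ^ (N - 1) - 1)"

text \<open>The \<open>k\<close>-dimensional subspaces that meet \<open>B\<close>.\<close>

definition meeting :: "'c set set" where
  "meeting = {C \<in> subspaces_above k {}. C \<inter> B \<noteq> {}}"

lemma finite_B: "finite B"
  using B_subset finite_vectors by (meson Diff_subset finite_subset order_trans)

lemma span_singleton_Int_B:
  assumes u: "u \<in> B" shows "span {u} \<inter> B = span {u} - {\<zero>\<^bsub>V\<^esub>}"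
proof -
  have uV: "u \<in> carrier V" using u B_subset by auto
  have "v \<in> B" if v: "v \<in> span {u}" "v \<noteq> \<zero>\<^bsub>V\<^esub>" for v
  proof -
    obtain a where a: "a \<in> {u} \<rightarrow> carrier K" "lincomb a {u} = v"
      using finite_in_span[of "{u}" v] v uV by auto
    have va: "v = a u \<odot>\<^bsub>V\<^esub> u" using a uV by (simp add: lincomb_def)
    then have "a u \<noteq> \<zero>\<^bsub>K\<^esub>" using v(2) uV by auto
    with a(1) u va show ?thesis using B_smult by auto
  qed
  then show ?thesis using B_subset by auto
qed

lemma card_span_singleton_Int_B:
  assumes u: "u \<in> B" shows "card (span {u} \<inter> B) = q - 1"
proof -
  have u': "u \<in> carrier V" "u \<noteq> \<zero>\<^bsub>V\<^esub>" using u B_subset by auto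
  have "card (span {u}) = q" using card_span[of "{u}"] lin_indpt_singleton[OF u'] u' by simp
  then show ?thesis
    unfolding span_singleton_Int_B[OF u] using u' by (simp add: span_zero)
qed

lemma card_B_ge: "B \<noteq> {} \<Longrightarrow> q - 1 \<le> card B"
  using card_span_singleton_Int_B card_mono[OF finite_B, of "span {_} \<inter> B"]
  by (metis Int_lower2 ex_in_conv)

lemma N1_pos: "0 < N1"
  by (rule gauss_from_pos[OF card_scalars_ge_2 k(2)])

lemma card_Int_eq_sum: "real (card (C \<inter> B)) = (\<Sum>v\<in>B. of_bool (v \<in> C))"
  using finite_B by (simp add: Int_commute)

lemma sum_card_Int: "(\<Sum>C\<in>subspaces_above k {}. real (card (C \<inter> B))) = real (card B) * N1"
proof -
  have "(\<Sum>C\<in>subspaces_above k {}. real (card (C \<inter> B)))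
      = (\<Sum>v\<in>B. \<Sum>C\<in>subspaces_above k {}. of_bool (v \<in> C))"
    unfolding card_Int_eq_sum by (rule sum.swap)
  also have "\<dots> = (\<Sum>v\<in>B. N1)"
  proof (rule sum.cong[OF refl])
    fix v assume "v \<in> B"
    then have v: "v \<in> carrier V" "v \<noteq> \<zero>\<^bsub>V\<^esub>" using B_subset by auto
    have "(\<Sum>C\<in>subspaces_above k {}. of_bool (v \<in> C)) = real (card (subspaces_above k {v}))"
      using finite_subspaces_above[of k "{}"] subspaces_above_filter[of k "{v}"] by simp
    then show "(\<Sum>C\<in>subspaces_above k {}. of_bool (v \<in> C)) = N1"
      using card_subspaces_above_singleton[OF v k card_V] by simp
  qed
  finally show ?thesis by simp
qed

lemma sum_card_Int_squared:
  "(\<Sum>C\<in>subspaces_above k {}. (real (card (C \<inter> B)))\<^sup>2)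
    = real (card B) * N1 * (real q - 1 + (real (card B) - (real q - 1)) * \<rho>)"
proof -
  have q: "2 \<le> q" by (rule card_scalars_ge_2)
  have "(\<Sum>C\<in>subspaces_above k {}. (real (card (C \<inter> B)))\<^sup>2)
      = (\<Sum>C\<in>subspaces_above k {}. \<Sum>u\<in>B. \<Sum>v\<in>B. of_bool (u \<in> C \<and> v \<in> C))"
    unfolding card_Int_eq_sum power2_eq_square sum_product of_bool_conj ..
  also have "\<dots> = (\<Sum>u\<in>B. \<Sum>v\<in>B. \<Sum>C\<in>subspaces_above k {}. of_bool (u \<in> C \<and> v \<in> C))"
    by (subst sum.swap, rule sum.cong[OF refl], rule sum.swap)
  also have "\<dots> = (\<Sum>u\<in>B. \<Sum>v\<in>B. if v \<in> span {u} then N1 else N1 * \<rho>)"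
  proof (intro sum.cong refl)
    fix u v assume "u \<in> B" "v \<in> B"
    then have u: "u \<in> carrier V" "u \<noteq> \<zero>\<^bsub>V\<^esub>" and v: "v \<in> carrier V" using B_subset by auto
    have "(\<Sum>C\<in>subspaces_above k {}. of_bool (u \<in> C \<and> v \<in> C))
        = real (card (subspaces_above k {u, v}))"
      using finite_subspaces_above[of k "{}"] subspaces_above_filter[of k "{u, v}"] by simp
    moreover have "subspaces_above k {u, v} = subspaces_above k {u}" if "v \<in> span {u}"
      using that span_subset_subspace[of _ "{u}"] by (auto simp: subspaces_above_def)
    ultimately show "(\<Sum>C\<in>subspaces_above k {}. of_bool (u \<in> C \<and> v \<in> C))
        = (if v \<in> span {u} then N1 else N1 * \<rho>)"
      using card_subspaces_above_singleton[OF u k card_V]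
        card_subspaces_above_pair[OF u v _ k card_V] by simp
  qed
  also have "\<dots> = (\<Sum>u\<in>B. (real q - 1) * N1 + (real (card B) - (real q - 1)) * (N1 * \<rho>))"
  proof (rule sum.cong[OF refl])
    fix u assume u: "u \<in> B"
    have c: "card (B \<inter> span {u}) = q - 1"
      using card_span_singleton_Int_B[OF u] by (simp add: Int_commute)
    have "B \<inter> - span {u} = B - B \<inter> span {u}" by auto
    then have "card (B \<inter> - span {u}) = card B - (q - 1)"
      using c finite_B by (simp add: card_Diff_subset)
    moreover have "q - 1 \<le> card B" using card_B_ge u by auto
    ultimately have "real (card (B \<inter> - span {u})) = real (card B) - (real q - 1)"
      using q by (simp add: of_nat_diff)
    with c show "(\<Sum>v\<in>B. if v \<in> span {u} then N1 else N1 * \<rho>)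
        = (real q - 1) * N1 + (real (card B) - (real q - 1)) * (N1 * \<rho>)"
      using finite_B q by (simp add: sum.If_cases of_nat_diff Collect_conj_eq)
  qed
  finally show ?thesis by (simp add: algebra_simps)
qed

lemma card_meeting_le: "(real q - 1) * real (card meeting) \<le> real (card B) * N1"
proof -
  have "(real q - 1) * real (card meeting) = (\<Sum>C\<in>meeting. real q - 1)" by simp
  also have "\<dots> \<le> (\<Sum>C\<in>meeting. real (card (C \<inter> B)))"
  proof (rule sum_mono)
    fix C assume "C \<in> meeting"
    then obtain u where C: "subspace K C V" and u: "u \<in> C" "u \<in> B"
      by (auto simp: meeting_def subspaces_above_def)
    have "span {u} \<inter> B \<subseteq> C \<inter> B" using span_subset_subspace[OF C] u by auto
    then have "card (span {u} \<inter> B) \<le> card (C \<inter> B)" using finite_B by (intro card_mono) auto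
    then show "real q - 1 \<le> real (card (C \<inter> B))" using card_span_singleton_Int_B[OF u(2)] by simp
  qed
  also have "\<dots> \<le> (\<Sum>C\<in>subspaces_above k {}. real (card (C \<inter> B)))"
    by (rule sum_mono2[OF finite_subspaces_above]) (auto simp: meeting_def)
  finally show ?thesis by (simp add: sum_card_Int)
qed

lemma card_meeting_ge:
  "real (card B) * N1
    \<le> real (card meeting) * (real q - 1 + (real (card B) - (real q - 1)) * \<rho>)"
proof (cases "B = {}")
  case True
  have "meeting = {}" unfolding meeting_def using True by blast
  with True show ?thesis by simp
next
  case False
  then have B: "0 < real (card B) * N1" using finite_B N1_pos by (simp add: card_gt_0_iff)
  have fin: "finite meeting" using finite_subspaces_above by (simp add: meeting_def)
  \<comment> \<open>Both moments may be computed over the subspaces that meet \<open>B\<close>, so that the constant factor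
      in the Cauchy-Schwarz inequality is their number.\<close>
  have restr: "(\<Sum>C\<in>meeting. f (real (card (C \<inter> B))))
      = (\<Sum>C\<in>subspaces_above k {}. f (real (card (C \<inter> B))))" if "f 0 = 0" for f :: "real \<Rightarrow> real"
    using that by (intro sum.mono_neutral_left[OF finite_subspaces_above]) (auto simp: meeting_def)
  have "(real (card B) * N1)\<^sup>2 = (\<Sum>C\<in>meeting. real (card (C \<inter> B)))\<^sup>2"
    using restr[of "\<lambda>x. x"] by (simp add: sum_card_Int)
  also have "\<dots> \<le> (\<Sum>C\<in>meeting. (real (card (C \<inter> B)))\<^sup>2) * real (card meeting)"
    by (rule sum_squared_le_sum_of_squares)
  also have "(\<Sum>C\<in>meeting. (real (card (C \<inter> B)))\<^sup>2)
      = real (card B) * N1 * (real q - 1 + (real (card B) - (real q - 1)) * \<rho>)"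
    using restr[of "\<lambda>x. x\<^sup>2"] by (simp add: sum_card_Int_squared)
  finally have "real (card B) * N1 * (real (card B) * N1)
      \<le> real (card B) * N1 * (real (card meeting) * (real q - 1 + (real (card B) - (real q - 1)) * \<rho>))"
    by (simp add: power2_eq_square mult_ac)
  then show ?thesis using B by (simp only: mult_le_cancel_left_pos)
qed

end

section \<open>Families of vectors of bounded rank\<close>

context finite_vectorspace
begin

text \<open>Families of vectors indexed by \<open>I\<close> all of whose members lie in the span of the members
  with index in \<open>J\<close>.\<close>

definition generated_families :: "'i set \<Rightarrow> 'i set \<Rightarrow> ('i \<Rightarrow> 'c) set" where
  "generated_families I J = {c \<in> I \<rightarrow>\<^sub>E carrier V. c ` I \<subseteq> span (c ` J)}"

lemma finite_generated_families: "finite I \<Longrightarrow> finite (generated_families I J)"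
  unfolding generated_families_def
  by (rule finite_subset[of _ "I \<rightarrow>\<^sub>E carrier V"]) (auto simp: finite_vectors finite_PiE)

text \<open>The members with index in \<open>J\<close> are free, and each of the others ranges over their span.\<close>

lemma card_generated_families:
  assumes I: "finite I" and J: "J \<subseteq> I"
  shows "card (generated_families I J)
    = (\<Sum>g\<in>J \<rightarrow>\<^sub>E carrier V. card (span (g ` J)) ^ (card I - card J))"
proof -
  have finJ: "finite J" by (rule finite_subset[OF J I])
  have "bij_betw (\<lambda>c. (restrict c J, restrict c (I - J))) (generated_families I J)
      (SIGMA g : J \<rightarrow>\<^sub>E carrier V. (I - J) \<rightarrow>\<^sub>E span (g ` J))"
  proof (rule bij_betw_byWitness[where f' = "\<lambda>(g, h) x. if x \<in> J then g x else h x"])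
    show "\<forall>c\<in>generated_families I J.
        (\<lambda>(g, h) x. if x \<in> J then g x else h x) (restrict c J, restrict c (I - J)) = c"
      by (auto simp: generated_families_def fun_eq_iff PiE_def extensional_def)
    show "\<forall>p\<in>SIGMA g : J \<rightarrow>\<^sub>E carrier V. (I - J) \<rightarrow>\<^sub>E span (g ` J).
        (\<lambda>c. (restrict c J, restrict c (I - J))) ((\<lambda>(g, h) x. if x \<in> J then g x else h x) p) = p"
      by (auto simp: fun_eq_iff PiE_def extensional_def)
    show "(\<lambda>c. (restrict c J, restrict c (I - J))) ` generated_families I J
        \<subseteq> (SIGMA g : J \<rightarrow>\<^sub>E carrier V. (I - J) \<rightarrow>\<^sub>E span (g ` J))"
    proof
      fix p assume "p \<in> (\<lambda>c. (restrict c J, restrict c (I - J))) ` generated_families I J"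
      then obtain c where p: "p = (restrict c J, restrict c (I - J))"
        and c: "c \<in> I \<rightarrow>\<^sub>E carrier V" "c ` I \<subseteq> span (c ` J)"
        by (auto simp: generated_families_def)
      then show "p \<in> (SIGMA g : J \<rightarrow>\<^sub>E carrier V. (I - J) \<rightarrow>\<^sub>E span (g ` J))"
        using J by (auto simp: PiE_iff image_subset_iff)
    qed
    show "(\<lambda>(g, h) x. if x \<in> J then g x else h x)
        ` (SIGMA g : J \<rightarrow>\<^sub>E carrier V. (I - J) \<rightarrow>\<^sub>E span (g ` J)) \<subseteq> generated_families I J"
    proof clarify
      fix g h assume g: "g \<in> J \<rightarrow>\<^sub>E carrier V" and h: "h \<in> (I - J) \<rightarrow>\<^sub>E span (g ` J)"
      let ?c = "\<lambda>x. if x \<in> J then g x else h x"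
      have gV: "g ` J \<subseteq> carrier V" using g by auto
      have cJ: "?c ` J = g ` J" by auto
      have "?c x \<in> span (g ` J)" if "x \<in> I" for x
        using that h in_own_span[OF gV] by auto
      then have im: "?c ` I \<subseteq> span (g ` J)" by blast
      have "?c x = undefined" if "x \<notin> I" for x
        using that J h by (auto simp: PiE_iff extensional_def)
      then have "?c \<in> I \<rightarrow>\<^sub>E carrier V"
        using order_trans[OF im span_is_subset2[OF gV]] unfolding PiE_iff extensional_def by blast
      then show "?c \<in> generated_families I J"
        unfolding generated_families_def mem_Collect_eq cJ using im by blast
    qed
  qed
  then have "card (generated_families I J)
      = card (SIGMA g : J \<rightarrow>\<^sub>E carrier V. (I - J) \<rightarrow>\<^sub>E span (g ` J))"
    by (rule bij_betw_same_card)
  also have "\<dots> = (\<Sum>g\<in>J \<rightarrow>\<^sub>E carrier V. card ((I - J) \<rightarrow>\<^sub>E span (g ` J)))"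
  proof (rule card_SigmaI)
    show "finite (J \<rightarrow>\<^sub>E carrier V)" using finJ finite_vectors by (simp add: finite_PiE)
    show "\<forall>g\<in>J \<rightarrow>\<^sub>E carrier V. finite ((I - J) \<rightarrow>\<^sub>E span (g ` J))"
      using I by (auto intro!: finite_PiE finite_span_vectors)
  qed
  also have "\<dots> = (\<Sum>g\<in>J \<rightarrow>\<^sub>E carrier V. card (span (g ` J)) ^ (card I - card J))"
    using I J finJ by (simp add: card_PiE card_Diff_subset)
  finally show ?thesis .
qed

lemma card_generated_families_le:
  assumes I: "finite I" and J: "J \<subseteq> I" and N: "card (carrier V) = q ^ N"
  shows "card (generated_families I J) \<le> q ^ (card J * (N + card I - card J))"
proof -
  have finJ: "finite J" by (rule finite_subset[OF J I])
  have JI: "card J \<le> card I" by (rule card_mono[OF I J])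
  have "card (generated_families I J)
      \<le> (\<Sum>g\<in>J \<rightarrow>\<^sub>E carrier V. (q ^ card J) ^ (card I - card J))"
    unfolding card_generated_families[OF I J]
  proof (intro sum_mono power_mono)
    fix g assume "g \<in> J \<rightarrow>\<^sub>E carrier V"
    then have "g ` J \<subseteq> carrier V" by auto
    then have "card (span (g ` J)) \<le> q ^ card (g ` J)" by (rule card_span_le)
    also have "\<dots> \<le> q ^ card J"
      using card_scalars_ge_2 card_image_le[OF finJ] by (intro power_increasing) auto
    finally show "card (span (g ` J)) \<le> q ^ card J" .
  qed simp
  also have "\<dots> = q ^ (N * card J + card J * (card I - card J))"
    by (simp add: card_PiE finJ N power_add flip: power_mult)
  also have "N * card J + card J * (card I - card J) = card J * (N + card I - card J)"
    using JI by (simp add: algebra_simps diff_mult_distrib2)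
  finally show ?thesis .
qed

lemma card_indep_extensions_Nil:
  assumes N: "card (carrier V) = q ^ N"
  shows "card (indep_extensions (carrier V) [] r) = (\<Prod>i<r. q ^ N - q ^ i)"
proof -
  have "subspace K (carrier V) V"
    using vectorspace_axioms module_axioms by (auto simp: subspace_def submodule_def)
  from card_indep_extensions[OF this N, of "[]" r] show ?thesis by (simp add: lin_indpt_empty)
qed

text \<open>Only the families whose first \<open>r\<close> members are independent are counted.\<close>

lemma card_generated_families_ge:
  assumes r: "r \<le> m" and N: "card (carrier V) = q ^ N"
  shows "(\<Prod>i<r. q ^ N - q ^ i) * q ^ (r * (m - r)) \<le> card (generated_families {..<m} {..<r})"
proof -
  let ?f = "\<lambda>xs :: 'c list. \<lambda>i\<in>{..<r}. xs ! i"
  let ?L = "indep_extensions (carrier V) [] r"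
  have inj: "inj_on ?f ?L"
  proof (rule inj_onI)
    fix xs ys assume L: "xs \<in> ?L" "ys \<in> ?L" and eq: "?f xs = ?f ys"
    show "xs = ys"
    proof (rule nth_equalityI)
      show "length xs = length ys" using L by (simp add: indep_extensions_def)
      fix i assume "i < length xs"
      then show "xs ! i = ys ! i"
        using L fun_cong[OF eq, of i] by (simp add: indep_extensions_def)
    qed
  qed
  have "(\<Prod>i<r. q ^ N - q ^ i) * q ^ (r * (m - r)) = (\<Sum>xs\<in>?L. (q ^ r) ^ (m - r))"
    by (simp add: card_indep_extensions_Nil[OF N] power_mult)
  also have "\<dots> = (\<Sum>xs\<in>?L. card (span (?f xs ` {..<r})) ^ (m - r))"
  proof (rule sum.cong[OF refl])
    fix xs assume xs: "xs \<in> ?L"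
    then have "?f xs ` {..<r} = (!) xs ` {..<length xs}"
      by (auto simp: indep_extensions_def)
    also have "\<dots> = set xs" by (auto simp: set_conv_nth)
    finally show "(q ^ r) ^ (m - r) = card (span (?f xs ` {..<r})) ^ (m - r)"
      using card_span_append[OF _ _ xs] by simp
  qed
  also have "\<dots> = (\<Sum>g\<in>?f ` ?L. card (span (g ` {..<r})) ^ (m - r))"
    by (simp only: sum.reindex[OF inj] o_def)
  also have "\<dots> \<le> (\<Sum>g\<in>{..<r} \<rightarrow>\<^sub>E carrier V. card (span (g ` {..<r})) ^ (m - r))"
  proof (rule sum_mono2)
    show "finite ({..<r} \<rightarrow>\<^sub>E carrier V)" using finite_vectors by (simp add: finite_PiE)
    show "?f ` ?L \<subseteq> {..<r} \<rightarrow>\<^sub>E carrier V"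
      by (auto simp: indep_extensions_def restrict_PiE_iff split: if_splits)
  qed simp
  also have "\<dots> = card (generated_families {..<m} {..<r})"
    using r by (simp add: card_generated_families)
  finally show ?thesis .
qed

text \<open>A maximal independent subset of the family has at most \<open>r\<close> elements; its indices are
  padded to an index set of size exactly \<open>r\<close>.\<close>

lemma ex_generating_subfamily:
  assumes I: "finite I" and c: "c \<in> I \<rightarrow>\<^sub>E carrier V"
    and rank: "card (span (c ` I)) \<le> q ^ r" and r: "r \<le> card I"
  shows "\<exists>J \<subseteq> I. card J = r \<and> c \<in> generated_families I J"
proof -
  let ?P = "{S. S \<subseteq> c ` I \<and> lin_indpt S}"
  have cV: "c ` I \<subseteq> carrier V" using c by auto
  have "finite ?P" by (rule finite_subset[of _ "Pow (c ` I)"]) (use I in auto)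
  moreover have "?P \<noteq> {}" using lin_indpt_empty by auto
  ultimately have "\<exists>S\<in>?P. \<forall>T\<in>?P. S \<subseteq> T \<longrightarrow> S = T" by (rule finite_has_maximal)
  then obtain S where S: "S \<in> ?P" and max: "\<forall>T\<in>?P. S \<subseteq> T \<longrightarrow> S = T" by (rule bexE)
  have SV: "S \<subseteq> carrier V" using S cV by auto
  have gen: "c ` I \<subseteq> span S"
  proof
    fix v assume v: "v \<in> c ` I"
    show "v \<in> span S"
    proof (rule ccontr)
      assume nv: "v \<notin> span S"
      then have "v \<notin> S" using in_own_span[OF SV] by auto
      then have "insert v S \<in> ?P"
        using nv v S SV cV lin_indpt_insert_iff[OF SV, of v] by auto
      from max[rule_format, OF this] \<open>v \<notin> S\<close> show False by auto
    qed
  qed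
  have "q ^ card S = card (span S)" using card_span[OF SV] S by simp
  also have "\<dots> \<le> card (span (c ` I))"
    using S by (intro card_mono finite_span_vectors cV span_is_monotone) auto
  also note rank
  finally have Sr: "card S \<le> r" using card_scalars_ge_2 by simp
  obtain J0 where J0: "J0 \<subseteq> I" "inj_on c J0" "S = c ` J0"
    using S subset_image_inj[of S c I] by auto
  then obtain J where J: "J0 \<subseteq> J" "J \<subseteq> I" "card J = r"
    using exists_subset_between[of J0 r I] Sr r I card_image[of c J0] by auto
  have "span S \<subseteq> span (c ` J)" using J J0 by (intro span_is_monotone) auto
  then have "c \<in> generated_families I J" using gen c by (auto simp: generated_families_def)
  with J show ?thesis by auto
qed

text \<open>Families of \<open>m\<close> vectors that span a subspace of dimension at most \<open>r\<close>, expressed through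
  the cardinality of the span.\<close>

definition bounded_rank_families :: "nat \<Rightarrow> nat \<Rightarrow> (nat \<Rightarrow> 'c) set" where
  "bounded_rank_families m r = {c \<in> {..<m} \<rightarrow>\<^sub>E carrier V. card (span (c ` {..<m})) \<le> q ^ r}"

lemma finite_bounded_rank_families: "finite (bounded_rank_families m r)"
  unfolding bounded_rank_families_def
  by (rule finite_subset[of _ "{..<m} \<rightarrow>\<^sub>E carrier V"]) (auto simp: finite_vectors finite_PiE)

lemma card_bounded_rank_families_le:
  assumes r: "r \<le> m" and N: "card (carrier V) = q ^ N"
  shows "card (bounded_rank_families m r) \<le> (m choose r) * q ^ (r * (N + m - r))"
proof -
  let ?Js = "{J. J \<subseteq> {..<m} \<and> card J = r}"
  have fin: "finite ?Js" by (rule finite_subset[of _ "Pow {..<m}"]) auto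
  have "bounded_rank_families m r \<subseteq> (\<Union>J\<in>?Js. generated_families {..<m} J)"
    using ex_generating_subfamily[of "{..<m}" _ r] r
    by (fastforce simp: bounded_rank_families_def)
  then have "card (bounded_rank_families m r) \<le> card (\<Union>J\<in>?Js. generated_families {..<m} J)"
    using fin by (intro card_mono) (auto intro: finite_generated_families)
  also have "\<dots> \<le> (\<Sum>J\<in>?Js. card (generated_families {..<m} J))"
    by (rule card_UN_le[OF fin])
  also have "\<dots> \<le> (\<Sum>J\<in>?Js. q ^ (r * (N + m - r)))"
  proof (rule sum_mono)
    fix J assume "J \<in> ?Js"
    then show "card (generated_families {..<m} J) \<le> q ^ (r * (N + m - r))"
      using card_generated_families_le[of "{..<m}" J N] N by auto
  qed
  also have "\<dots> = (m choose r) * q ^ (r * (N + m - r))"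
    using n_subsets[of "{..<m}" r] by simp
  finally show ?thesis .
qed

lemma card_bounded_rank_families_ge:
  assumes r: "r \<le> m" "r \<le> N" and N: "card (carrier V) = q ^ N"
  shows "real q ^ (r * (N + m - r)) \<le> 2 ^ r * real (card (bounded_rank_families m r))"
proof -
  have q: "2 \<le> q" by (rule card_scalars_ge_2)
  \<comment> \<open>Each factor in the count of independent vectors loses at most a factor 2 against \<open>q ^ N\<close>.\<close>
  have half: "real q ^ N \<le> 2 * real (q ^ N - q ^ i)" if "i < r" for i
  proof -
    have "2 * q ^ i \<le> q ^ Suc i" using q by simp
    also have "\<dots> \<le> q ^ N" using that r q by (intro power_increasing) auto
    finally have "q ^ N \<le> 2 * (q ^ N - q ^ i)" by simp
    then have "real (q ^ N) \<le> real (2 * (q ^ N - q ^ i))" by (rule of_nat_mono)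
    then show ?thesis by simp
  qed
  have "r * (N + m - r) = N * r + r * (m - r)" using r by (simp add: algebra_simps diff_mult_distrib2)
  then have "real q ^ (r * (N + m - r)) = (\<Prod>i<r. real q ^ N) * real q ^ (r * (m - r))"
    by (simp add: power_add power_mult)
  also have "\<dots> \<le> (\<Prod>i<r. 2 * real (q ^ N - q ^ i)) * real q ^ (r * (m - r))"
    using half by (intro mult_right_mono prod_mono) auto
  also have "\<dots> = 2 ^ r * real ((\<Prod>i<r. q ^ N - q ^ i) * q ^ (r * (m - r)))"
    by (simp add: prod.distrib)
  also have "\<dots> \<le> 2 ^ r * real (card (generated_families {..<m} {..<r}))"
    by (intro mult_left_mono of_nat_mono card_generated_families_ge[OF r(1) N]) simp
  also have "\<dots> \<le> 2 ^ r * real (card (bounded_rank_families m r))"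
  proof (intro mult_left_mono of_nat_mono card_mono finite_bounded_rank_families)
    show "generated_families {..<m} {..<r} \<subseteq> bounded_rank_families m r"
    proof
      fix c assume c: "c \<in> generated_families {..<m} {..<r}"
      then have cV: "c ` {..<r} \<subseteq> carrier V" using r
        by (auto simp: generated_families_def PiE_iff)
      have "card (span (c ` {..<m})) \<le> card (span (c ` {..<r}))"
        using c by (intro card_mono finite_span_vectors span_subset_span cV)
          (simp add: generated_families_def)
      also have "\<dots> \<le> q ^ card (c ` {..<r})" by (rule card_span_le[OF cV])
      also have "\<dots> \<le> q ^ r"
        using q card_image_le[of "{..<r}" c] by (intro power_increasing) auto
      finally show "c \<in> bounded_rank_families m r"
        using c by (simp add: generated_families_def bounded_rank_families_def)
    qed
  qed simp
  finally show ?thesis .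
qed

end

section \<open>Matrices over a finite field\<close>

lemma func_space_finite_vectorspace:
  assumes "field F" "finite (carrier F)" "finite S"
  shows "finite_vectorspace F (ring.func_space F S)"
    and "card (carrier (ring.func_space F S)) = card (carrier F) ^ card S"
proof -
  interpret field F by (rule assms(1))
  have carrier: "carrier (func_space S) = S \<rightarrow>\<^sub>E carrier F" by (simp add: func_space_def)
  show "finite_vectorspace F (func_space S)"
    using func_space_is_module field_axioms assms carrier
    by (simp add: finite_vectorspace_def finite_vectorspace_axioms_def vectorspace_def finite_PiE)
  show "card (carrier (func_space S)) = card (carrier F) ^ card S"
    using assms(3) by (simp add: carrier card_PiE)
qed

text \<open>The spaces of columns of length \<open>n\<close> and of \<open>n \<times> m\<close> matrices over a finite field.\<close>

locale finite_field_matrices =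
  fixes F :: "('a, 'b) ring_scheme" and n m :: nat
  assumes field_F: "field F" and finite_F: "finite (carrier F)"
begin

sublocale col: finite_vectorspace F "col_space F n"
  unfolding col_space_def by (rule func_space_finite_vectorspace) (simp_all add: field_F finite_F)

sublocale mat: finite_vectorspace F "mat_space F n m"
  unfolding mat_space_def by (rule func_space_finite_vectorspace) (simp_all add: field_F finite_F)

abbreviation q :: nat where "q \<equiv> card (carrier F)"

lemma card_col_space: "card (carrier (col_space F n)) = q ^ n"
  unfolding col_space_def
  by (subst func_space_finite_vectorspace(2)) (simp_all add: field_F finite_F)

lemma card_mat_space: "card (carrier (mat_space F n m)) = q ^ (m * n)"
  unfolding mat_space_def
  by (subst func_space_finite_vectorspace(2)) (simp_all add: field_F finite_F mult.commute)

lemma carrier_mat_space: "carrier (mat_space F n m) = {..<n} \<times> {..<m} \<rightarrow>\<^sub>E carrier F"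
  by (simp add: mat_space_def col.func_space_def)

lemma carrier_col_space: "carrier (col_space F n) = {..<n} \<rightarrow>\<^sub>E carrier F"
  by (simp add: col_space_def col.func_space_def)

lemma mat_col_closed: "M \<in> carrier (mat_space F n m) \<Longrightarrow> j < m \<Longrightarrow> mat_col n M j \<in> carrier (col_space F n)"
  by (auto simp: carrier_mat_space carrier_col_space mat_col_def)

lemma mat_cols_subset:
  "M \<in> carrier (mat_space F n m) \<Longrightarrow> mat_col n M ` {..<m} \<subseteq> carrier (col_space F n)"
  using mat_col_closed by auto

lemma mat_rank_le_iff:
  assumes "M \<in> carrier (mat_space F n m)"
  shows "mat_rank F n m M \<le> r \<longleftrightarrow> card (col.span (mat_col n M ` {..<m})) \<le> q ^ r"
  unfolding mat_rank_def subspace_dim_def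
  by (rule col.dim_le_iff_card[OF col.span_is_subspace[OF mat_cols_subset[OF assms]]])

text \<open>A matrix is the family of its columns, and its rank is the dimension of their span.\<close>

lemma num_rank_le_eq: "num_rank_le F n m r = card (col.bounded_rank_families m r)"
  unfolding num_rank_le_def
proof (rule bij_betw_same_card, rule bij_betw_byWitness)
  let ?f = "\<lambda>M. \<lambda>j\<in>{..<m}. mat_col n M j"
  let ?g = "\<lambda>c. \<lambda>(i, j)\<in>{..<n} \<times> {..<m}. c j i"
  show "\<forall>M\<in>{M \<in> carrier (mat_space F n m). mat_rank F n m M \<le> r}. ?g (?f M) = M"
    by (auto simp: carrier_mat_space mat_col_def fun_eq_iff PiE_iff extensional_def)
  have gf: "?f (?g c) = c" if "c \<in> {..<m} \<rightarrow>\<^sub>E carrier (col_space F n)" for c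
    using that unfolding carrier_col_space
    by (fastforce simp: mat_col_def fun_eq_iff PiE_iff extensional_def)
  then show "\<forall>c\<in>col.bounded_rank_families m r. ?f (?g c) = c"
    by (simp add: col.bounded_rank_families_def)
  show "?f ` {M \<in> carrier (mat_space F n m). mat_rank F n m M \<le> r} \<subseteq> col.bounded_rank_families m r"
    by (auto simp: col.bounded_rank_families_def mat_rank_le_iff mat_col_closed)
  show "?g ` col.bounded_rank_families m r \<subseteq> {M \<in> carrier (mat_space F n m). mat_rank F n m M \<le> r}"
  proof (rule image_subsetI)
    fix c assume "c \<in> col.bounded_rank_families m r"
    then have c: "c \<in> {..<m} \<rightarrow>\<^sub>E carrier (col_space F n)" "card (col.span (c ` {..<m})) \<le> q ^ r"
      by (auto simp: col.bounded_rank_families_def)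
    have "?g c \<in> carrier (mat_space F n m)"
      using c(1) by (auto simp: carrier_mat_space carrier_col_space PiE_iff)
    moreover have "mat_col n (?g c) ` {..<m} = c ` {..<m}"
    proof (rule image_cong[OF refl])
      fix j assume "j \<in> {..<m}"
      then show "mat_col n (?g c) j = c j" using fun_cong[OF gf[OF c(1)], of j] by simp
    qed
    ultimately show "?g c \<in> {M \<in> carrier (mat_space F n m). mat_rank F n m M \<le> r}"
      using c(2) by (simp add: mat_rank_le_iff)
  qed
qed

lemma mat_rank_zero: "mat_rank F n m \<zero>\<^bsub>mat_space F n m\<^esub> \<le> r"
proof -
  let ?z = "\<zero>\<^bsub>mat_space F n m\<^esub>"
  have "mat_col n ?z ` {..<m} \<subseteq> {\<zero>\<^bsub>col_space F n\<^esub>}"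
    by (auto simp: mat_col_def mat_space_def col_space_def col.func_space_def)
  also have "\<dots> = col.span {}" by (simp add: col.span_empty)
  finally have "card (col.span (mat_col n ?z ` {..<m})) \<le> card (col.span {})"
    by (intro card_mono col.finite_span_vectors col.span_subset_span) auto
  also have "\<dots> = 1" by (simp add: col.span_empty)
  also have "\<dots> \<le> q ^ r" using col.card_scalars_ge_2 by simp
  finally show ?thesis by (simp add: mat_rank_le_iff)
qed

lemma mat_rank_smult_le:
  assumes a: "a \<in> carrier F" and M: "M \<in> carrier (mat_space F n m)"
  shows "mat_rank F n m (a \<odot>\<^bsub>mat_space F n m\<^esub> M) \<le> mat_rank F n m M"
proof -
  let ?N = "a \<odot>\<^bsub>mat_space F n m\<^esub> M"
  have N: "?N \<in> carrier (mat_space F n m)" using a M by (rule mat.smult_closed)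
  have sub: "mat_col n ?N ` {..<m} \<subseteq> col.span (mat_col n M ` {..<m})"
  proof (rule image_subsetI)
    fix j assume j: "j \<in> {..<m}"
    have "mat_col n ?N j = a \<odot>\<^bsub>col_space F n\<^esub> mat_col n M j"
      using j by (auto simp: mat_col_def mat_space_def col_space_def col.func_space_def)
    moreover have "mat_col n M j \<in> col.span (mat_col n M ` {..<m})"
      using col.in_own_span[OF mat_cols_subset[OF M]] j by auto
    ultimately show "mat_col n ?N j \<in> col.span (mat_col n M ` {..<m})"
      using submodule.smult_closed[OF col.span_is_submodule[OF mat_cols_subset[OF M]] a] by simp
  qed
  have "card (col.span (mat_col n ?N ` {..<m})) \<le> card (col.span (mat_col n M ` {..<m}))"
    using sub mat_cols_subset[OF M]
    by (intro card_mono col.finite_span_vectors col.span_subset_span)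
  then show ?thesis
    using mat_rank_le_iff[OF M, of "mat_rank F n m M"]
    by (simp add: mat_rank_le_iff[OF N])
qed

text \<open>The nonzero matrices of rank at most \<open>r\<close>.\<close>

definition low_rank :: "nat \<Rightarrow> (nat \<times> nat \<Rightarrow> 'a) set" where
  "low_rank r = {M \<in> carrier (mat_space F n m). M \<noteq> \<zero>\<^bsub>mat_space F n m\<^esub> \<and> mat_rank F n m M \<le> r}"

lemma card_low_rank: "real (card (low_rank r)) = real (num_rank_le F n m r) - 1"
proof -
  let ?A = "{M \<in> carrier (mat_space F n m). mat_rank F n m M \<le> r}"
  have fin: "finite ?A" using mat.finite_vectors by simp
  have z: "\<zero>\<^bsub>mat_space F n m\<^esub> \<in> ?A" by (simp add: mat_rank_zero)
  have "low_rank r = ?A - {\<zero>\<^bsub>mat_space F n m\<^esub>}" by (auto simp: low_rank_def)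
  then have "card (low_rank r) = card ?A - 1" using z by simp
  moreover have "0 < card ?A" unfolding card_gt_0_iff using fin z by blast
  ultimately show ?thesis by (simp add: num_rank_le_def of_nat_diff)
qed

lemma low_rank_smult:
  assumes a: "a \<in> carrier F" "a \<noteq> \<zero>\<^bsub>F\<^esub>" and M: "M \<in> low_rank r"
  shows "a \<odot>\<^bsub>mat_space F n m\<^esub> M \<in> low_rank r"
proof -
  have M': "M \<in> carrier (mat_space F n m)" "M \<noteq> \<zero>\<^bsub>mat_space F n m\<^esub>" "mat_rank F n m M \<le> r"
    using M by (auto simp: low_rank_def)
  have "a \<odot>\<^bsub>mat_space F n m\<^esub> M \<noteq> \<zero>\<^bsub>mat_space F n m\<^esub>"
  proof
    assume "a \<odot>\<^bsub>mat_space F n m\<^esub> M = \<zero>\<^bsub>mat_space F n m\<^esub>"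
    from mat.mult_inverse[OF a(1) M'(1) this a(2)] show False
      using M'(2) a by simp
  qed
  then show ?thesis
    using mat_rank_smult_le[OF a(1) M'(1)] M' a by (simp add: low_rank_def)
qed

lemma le_min_distance_iff:
  assumes C: "rank_metric_code F n m C"
  shows "d \<le> min_distance F n m C
    \<longleftrightarrow> (\<forall>M\<in>C. M \<noteq> \<zero>\<^bsub>mat_space F n m\<^esub> \<longrightarrow> d \<le> mat_rank F n m M)"
proof -
  let ?R = "{mat_rank F n m M | M. M \<in> C \<and> M \<noteq> \<zero>\<^bsub>mat_space F n m\<^esub>}"
  have sub: "subspace F C (mat_space F n m)" and ne: "C \<noteq> {\<zero>\<^bsub>mat_space F n m\<^esub>}"
    using C by (auto simp: rank_metric_code_def)
  have "\<zero>\<^bsub>mat_space F n m\<^esub> \<in> C" using sub submodule.zero_closed[OF mat.is_module] by metis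
  then obtain M where M: "M \<in> C" "M \<noteq> \<zero>\<^bsub>mat_space F n m\<^esub>" using ne by blast
  have "finite ?R" using mat.finite_subspace[OF sub] by simp
  moreover have "?R \<noteq> {}" using M by blast
  ultimately show ?thesis unfolding min_distance_def by (subst Min_ge_iff) auto
qed

end

text \<open>Codes of dimension \<open>k\<close> and minimum distance at least \<open>r + 1\<close>, as the subspaces that do not
  meet the matrices of rank at most \<open>r\<close>.\<close>

locale code_counting = finite_field_matrices F n m for F :: "('a, 'b) ring_scheme" and n m +
  fixes k r :: nat
  assumes k: "1 \<le> k" "k \<le> m * n"
begin

sublocale scaling_closed_set F "mat_space F n m" "low_rank r" k "m * n"
  by unfold_locales
    (use k card_mat_space low_rank_smult in \<open>auto simp: low_rank_def\<close>)

lemma code_density_eq: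
  "code_density F n m k (Suc r) = 1 - real (card meeting) / q_binomial q (m * n) k"
proof -
  let ?S = "mat.subspaces_above k {}"
  have code: "rank_metric_code F n m C \<and> subspace_dim F (mat_space F n m) C = k \<longleftrightarrow> C \<in> ?S" for C
  proof -
    have "1 < q ^ k" using k col.card_scalars_ge_2 by (intro one_less_power) auto
    then show ?thesis
      using mat.dim_eq_iff_card[of C k]
      by (auto simp: rank_metric_code_def mat.subspaces_above_def subspace_dim_def)
  qed
  have "{C. rank_metric_code F n m C \<and> subspace_dim F (mat_space F n m) C = k
      \<and> Suc r \<le> min_distance F n m C} = ?S - meeting"
  proof (rule Set.set_eqI)
    fix C
    have "Suc r \<le> min_distance F n m C \<longleftrightarrow> C \<inter> low_rank r = {}" if "C \<in> ?S"
    proof -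
      have "C \<subseteq> carrier (mat_space F n m)"
        using that mat.subspace_subset by (simp add: mat.subspaces_above_def)
      then have "M \<in> low_rank r
          \<longleftrightarrow> M \<noteq> \<zero>\<^bsub>mat_space F n m\<^esub> \<and> \<not> Suc r \<le> mat_rank F n m M" if "M \<in> C" for M
        using that by (auto simp: low_rank_def)
      moreover have "rank_metric_code F n m C" using code that by blast
      ultimately show ?thesis unfolding le_min_distance_iff[OF \<open>rank_metric_code F n m C\<close>] by blast
    qed
    then show "C \<in> {C. rank_metric_code F n m C \<and> subspace_dim F (mat_space F n m) C = k
        \<and> Suc r \<le> min_distance F n m C} \<longleftrightarrow> C \<in> ?S - meeting"
      unfolding meeting_def Diff_iff mem_Collect_eq using code[of C] by blast
  qed
  moreover have "card (?S - meeting) = card ?S - card meeting" "card meeting \<le> card ?S"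
  proof -
    have "meeting \<subseteq> ?S" unfolding meeting_def by blast
    then show "card (?S - meeting) = card ?S - card meeting" "card meeting \<le> card ?S"
      using mat.finite_subspaces_above[of k "{}"]
      by (auto intro!: card_Diff_subset card_mono intro: finite_subset)
  qed
  moreover have "real (card ?S) = q_binomial q (m * n) k"
    by (rule mat.card_subspaces_above_empty[OF k(2) card_mat_space])
  moreover have "0 < q_binomial q (m * n) k"
    using gauss_from_pos[OF col.card_scalars_ge_2 k(2), of 0] by (simp add: gauss_from_0)
  ultimately show ?thesis
    by (simp add: code_density_def of_nat_diff diff_divide_distrib)
qed

end

section \<open>Bounds for the density of codes\<close>

context code_counting
begin

text \<open>The number of matrices of rank at most \<open>r\<close>, zero included, and the proportion of
  \<open>k\<close>-dimensional subspaces that contain a given nonzero matrix.\<close>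

abbreviation b :: real where "b \<equiv> real (num_rank_le F n m r)"
abbreviation P :: real where "P \<equiv> (real q ^ k - 1) / (real q ^ (m * n) - 1)"

lemma q_binomial_pos: "0 < q_binomial q (m * n) k"
  using gauss_from_pos[OF col.card_scalars_ge_2 k(2), of 0] by (simp add: gauss_from_0)

lemma N1_eq: "N1 = q_binomial q (m * n) k * P"
  by (rule gauss_from_Suc_0[OF col.card_scalars_ge_2 k])

lemma one_minus_code_density_le:
  "1 - code_density F n m k (Suc r)
    \<le> (b - 1) * q_binomial q (m * n - 1) (k - 1) / ((real q - 1) * q_binomial q (m * n) k)"
proof -
  have q: "0 < real q - 1" using col.card_scalars_ge_2 by simp
  have "real (card meeting) / q_binomial q (m * n) k
      = (real q - 1) * real (card meeting) / ((real q - 1) * q_binomial q (m * n) k)"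
    using q by simp
  also have "\<dots> \<le> (b - 1) * N1 / ((real q - 1) * q_binomial q (m * n) k)"
    using card_meeting_le q q_binomial_pos
    by (intro divide_right_mono) (auto simp: card_low_rank)
  finally show ?thesis
    by (simp only: code_density_eq q_binomial_pred[OF col.card_scalars_ge_2 k])
qed

lemma \<rho>_bounds: "0 \<le> \<rho>" "\<rho> \<le> 1" "\<rho> \<le> P"
proof -
  have q: "2 \<le> q" by (rule col.card_scalars_ge_2)
  define x y where "x = real q ^ (k - 1)" and "y = real q ^ (m * n - 1)"
  have x: "1 \<le> x" and xy: "x \<le> y"
    unfolding x_def y_def using q k by (auto intro!: power_increasing)
  have qx: "real q ^ k = real q * x" and qy: "real q ^ (m * n) = real q * y"
    unfolding x_def y_def using k power_minus_mult[of k "real q"] power_minus_mult[of "m * n" "real q"]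
    by (simp_all only: mult.commute[of _ "real q"])
  show "0 \<le> \<rho>" "\<rho> \<le> 1"
    unfolding x_def[symmetric] y_def[symmetric] using x xy by (auto simp: divide_le_eq_1)
  have qy1: "1 < real q * y"
  proof -
    have "2 * 1 \<le> real q * y" using q x xy by (intro mult_mono) auto
    then show ?thesis by simp
  qed
  show "\<rho> \<le> P"
  proof (cases "y = 1")
    case True
    then show ?thesis
      unfolding qx qy x_def[symmetric] y_def[symmetric] using x xy by simp
  next
    case False
    then have "1 < y" using x xy by simp
    moreover have "(x - 1) * (real q * y - 1) \<le> (real q * x - 1) * (y - 1)"
    proof -
      have "(real q - 1) * x \<le> (real q - 1) * y" using xy q by (intro mult_left_mono) auto
      then show ?thesis by (simp add: algebra_simps)
    qed
    ultimately show ?thesis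
      unfolding qx qy x_def[symmetric] y_def[symmetric] using qy1 by (simp add: field_simps)
  qed
qed

lemma second_moment_denominator_pos:
  assumes "low_rank r \<noteq> {}"
  shows "0 < real q - 1 + (b - real q) * \<rho>"
proof -
  have "real q - 1 \<le> b - 1"
    using card_B_ge[OF assms] col.card_scalars_ge_2 by (simp flip: card_low_rank)
  then have "0 \<le> (b - real q) * \<rho>" using \<rho>_bounds(1) by (intro mult_nonneg_nonneg) simp_all
  then show ?thesis using col.card_scalars_ge_2 by simp
qed

lemma code_density_nonneg: "0 \<le> code_density F n m k (Suc r)"
  using q_binomial_pos by (simp add: code_density_def)

lemma code_density_le_1: "code_density F n m k (Suc r) \<le> 1"
  using q_binomial_pos by (simp add: code_density_eq)

lemma code_density_le:
  "code_density F n m k (Suc r)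
    \<le> 1 - (b - 1) * P / (real q - 1 + (b - real q) * \<rho>)"
proof (cases "low_rank r = {}")
  case True
  then have "b = 1" using card_low_rank[of r] by simp
  then show ?thesis using code_density_le_1 by simp
next
  case False
  let ?D = "real q - 1 + (b - real q) * \<rho>"
  have D: "0 < ?D" by (rule second_moment_denominator_pos[OF False])
  have "(b - 1) * (q_binomial q (m * n) k * P) \<le> real (card meeting) * ?D"
    using card_meeting_ge by (simp only: card_low_rank N1_eq) (simp add: algebra_simps)
  then have "(b - 1) * P * q_binomial q (m * n) k \<le> real (card meeting) * ?D"
    by (simp only: mult_ac)
  then have "(b - 1) * P / ?D \<le> real (card meeting) / q_binomial q (m * n) k"
    using D q_binomial_pos by (simp only: pos_divide_le_eq pos_le_divide_eq times_divide_eq_left)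
  then show ?thesis by (simp add: code_density_eq)
qed

text \<open>The denominator \<open>D = q - 1 + (b - q) \<rho>\<close> of the second-moment bound is at least
  \<open>(b - 1) \<rho>\<close> because \<open>\<rho> \<le> 1\<close>, and it exceeds \<open>(b - 1) P\<close> by at most \<open>q - 1\<close> because \<open>0 \<le> \<rho> \<le> P\<close>. This
  form of the bound shows the decay of the density directly.\<close>

lemma code_density_mult_le: "code_density F n m k (Suc r) * ((b - 1) * \<rho>) \<le> real q - 1"
proof (cases "low_rank r = {}")
  case True
  then have "b = 1" using card_low_rank[of r] by simp
  then show ?thesis using col.card_scalars_ge_2 by simp
next
  case False
  let ?D = "real q - 1 + (b - real q) * \<rho>"
  have q: "1 \<le> real q" using col.card_scalars_ge_2 by simp
  have b: "1 \<le> b" using card_low_rank[of r] by (simp add: algebra_simps)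
  have D: "0 < ?D" by (rule second_moment_denominator_pos[OF False])
  have "(b - 1) * \<rho> \<le> ?D"
  proof -
    have "0 \<le> (real q - 1) * (1 - \<rho>)" using q \<rho>_bounds by (intro mult_nonneg_nonneg) auto
    then show ?thesis by (simp only: algebra_simps)
  qed
  then have "code_density F n m k (Suc r) * ((b - 1) * \<rho>) \<le> code_density F n m k (Suc r) * ?D"
    using code_density_nonneg by (rule mult_left_mono)
  also have "\<dots> \<le> (1 - (b - 1) * P / ?D) * ?D"
    using code_density_le D by (intro mult_right_mono) auto
  also have "\<dots> = ?D - (b - 1) * P" using D by (simp only: left_diff_distrib) simp
  also have "\<dots> \<le> real q - 1"
  proof -
    have "(b - 1) * \<rho> \<le> (b - 1) * P" using b \<rho>_bounds by (intro mult_left_mono) auto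
    moreover have "0 \<le> (real q - 1) * \<rho>" using q \<rho>_bounds by (intro mult_nonneg_nonneg) auto
    ultimately show ?thesis by (simp only: algebra_simps)
  qed
  finally show ?thesis .
qed

lemma one_minus_code_density_le_power:
  assumes r_le: "r \<le> m"
  shows "1 - code_density F n m k (Suc r)
    \<le> 2 * real (m choose r)
      * (real q ^ (r * (n + m - r)) * real q ^ k / (real q ^ (m * n) * real q))"
proof -
  let ?e = "r * (n + m - r)"
  have q: "2 \<le> q" by (rule col.card_scalars_ge_2)
  have b_le: "b \<le> real (m choose r) * real q ^ ?e"
  proof -
    have "num_rank_le F n m r \<le> (m choose r) * q ^ ?e"
      unfolding num_rank_le_eq
      by (rule col.card_bounded_rank_families_le[OF _ card_col_space]) (use r_le in simp)
    then have "b \<le> real ((m choose r) * q ^ ?e)" by (rule of_nat_mono)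
    then show ?thesis by simp
  qed
  have b1: "0 \<le> b - 1" using card_low_rank[of r] by (metis of_nat_0_le_iff)
  have qN: "1 < real q ^ (m * n)" using q k by (intro one_less_power) linarith+
  have P: "0 \<le> P" "P \<le> real q ^ k / real q ^ (m * n)"
  proof -
    show "0 \<le> P" using \<rho>_bounds by linarith
    have "real q ^ k \<le> real q ^ (m * n)" using q k by (intro power_increasing) auto
    moreover have "(X - 1) / (Y - 1) \<le> X / Y" if "X \<le> Y" "1 < Y" for X Y :: real
      using that by (simp add: field_simps)
    ultimately show "P \<le> real q ^ k / real q ^ (m * n)" using qN by blast
  qed
  have "1 - code_density F n m k (Suc r) \<le> (b - 1) * N1 / ((real q - 1) * q_binomial q (m * n) k)"
    using one_minus_code_density_le by (simp only: q_binomial_pred[OF q k])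
  also have "\<dots> = (b - 1) * P * (1 / (real q - 1))"
    unfolding N1_eq using q_binomial_pos by simp
  also have "\<dots> \<le> (real (m choose r) * real q ^ ?e) * (real q ^ k / real q ^ (m * n)) * (2 / real q)"
  proof (intro mult_mono)
    show "b - 1 \<le> real (m choose r) * real q ^ ?e" using b_le by simp
    show "1 / (real q - 1) \<le> 2 / real q" using q by (simp add: field_simps)
  qed (use P b1 q in simp_all)
  also have "\<dots> = 2 * real (m choose r) * (real q ^ ?e * real q ^ k / (real q ^ (m * n) * real q))"
    by simp
  finally show ?thesis .
qed

lemma code_density_le_power:
  assumes r: "1 \<le> r" "r + 1 \<le> n" and nm: "n \<le> m"
  shows "code_density F n m k (Suc r)
    \<le> 2 ^ (r + 2)
      * (real q * real q ^ (m * n) / (real q ^ (r * (n + m - r)) * real q ^ k))"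
proof -
  let ?e = "r * (n + m - r)"
  have q: "2 \<le> q" by (rule col.card_scalars_ge_2)
  show ?thesis
  proof (cases "k = 1")
    case True
    \<comment> \<open>Here \<open>\<rho> = 0\<close>, but the right-hand side is at least 1, since \<open>m n - r (n + m - r)\<close>
        equals \<open>(n - r) (m - r)\<close>.\<close>
    have "?e \<le> m * n"
    proof -
      obtain s t where "n = r + s" "m = r + t" using r nm by (metis add_leD1 le_Suc_ex le_trans)
      then show ?thesis by (simp add: algebra_simps)
    qed
    then have "real q ^ ?e \<le> real q ^ (m * n)" using q by (intro power_increasing) auto
    then have "1 \<le> real q * real q ^ (m * n) / (real q ^ ?e * real q ^ k)"
      using q True by (simp add: le_divide_eq)
    moreover have "(1 :: real) \<le> 2 ^ (r + 2)" by (rule one_le_power) simp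
    ultimately have "1 * 1 \<le> 2 ^ (r + 2) * (real q * real q ^ (m * n) / (real q ^ ?e * real q ^ k))"
      by (intro mult_mono) auto
    with code_density_le_1 show ?thesis by simp
  next
    case False
    have b_ge: "real q ^ ?e \<le> 2 ^ r * b"
      using col.card_bounded_rank_families_ge[OF _ _ card_col_space, of r m] r nm
      by (simp add: num_rank_le_eq)
    \<comment> \<open>Now \<open>b \<ge> 2\<close>, so that \<open>b - 1 \<ge> b / 2\<close>.\<close>
    have "2 ^ r * (2 :: real) \<le> 2 ^ r * 2 ^ r"
      using r by (intro mult_left_mono self_le_power) auto
    also have "\<dots> = 2 ^ (r * 2)" by (simp add: power_mult power2_eq_square power_mult_distrib)
    also have "\<dots> \<le> 2 ^ ?e" using r nm by (intro power_increasing mult_le_mono) auto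
    also have "\<dots> \<le> real q ^ ?e" using q by (intro power_mono) auto
    also note b_ge
    finally have b2: "2 \<le> b" by simp
    have k2: "2 \<le> k" using False k by simp
    have x: "2 \<le> real q ^ (k - 1)" and y: "2 \<le> real q ^ (m * n - 1)"
    proof -
      have q2: "2 \<le> real q" using q by simp
      have "real q \<le> real q ^ (k - 1)" by (rule self_le_power) (use q2 k2 in linarith)+
      with q2 show "2 \<le> real q ^ (k - 1)" by linarith
      have "real q \<le> real q ^ (m * n - 1)" by (rule self_le_power) (use q2 k2 k in linarith)+
      with q2 show "2 \<le> real q ^ (m * n - 1)" by linarith
    qed
    have "real q ^ k / (2 * real q ^ (m * n)) = (real q ^ (k - 1) / 2) / real q ^ (m * n - 1)"
    proof -
      have "real q ^ k = real q * real q ^ (k - 1)" "real q ^ (m * n) = real q * real q ^ (m * n - 1)"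
        using k power_minus_mult[of k "real q"] power_minus_mult[of "m * n" "real q"]
        by (simp_all only: mult.commute[of _ "real q"])
      then show ?thesis using q by simp
    qed
    also have "\<dots> \<le> \<rho>" using x y by (intro frac_le) auto
    finally have \<rho>_ge: "real q ^ k / (2 * real q ^ (m * n)) \<le> \<rho>" .
    have "code_density F n m k (Suc r) * (real q ^ ?e / 2 ^ (r + 1) * (real q ^ k / (2 * real q ^ (m * n))))
        \<le> code_density F n m k (Suc r) * ((b - 1) * \<rho>)"
    proof (intro mult_left_mono mult_mono code_density_nonneg)
      have "real q ^ ?e / 2 ^ (r + 1) \<le> b / 2" using b_ge by (simp add: field_simps)
      then show "real q ^ ?e / 2 ^ (r + 1) \<le> b - 1" using b2 by simp
    qed (use \<rho>_ge b2 in simp_all)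
    also have "\<dots> \<le> real q" using code_density_mult_le by simp
    finally show ?thesis using q by (simp add: field_simps)
  qed
qed

end

section \<open>The density of rank-metric codes for large fields\<close>

theorem theorem5p12:
  fixes F :: "nat \<Rightarrow> ('a, 'b) ring_scheme" and m n d k :: nat
  assumes mn: "2 \<le> n" "n \<le> m"
    and F: "\<And>q. primepow q \<Longrightarrow> field (F q) \<and> card (carrier (F q)) = q"
    and d: "2 \<le> d" "d \<le> n"
    and k: "1 \<le> k" "k \<le> m * n"
  shows
    "(\<forall>q. primepow q \<longrightarrow>
        1 - code_density (F q) n m k d
          \<le> (real (num_rank_le (F q) n m (d - 1)) - 1) * q_binomial q (m * n - 1) (k - 1)
             / ((real q - 1) * q_binomial q (m * n) k)
      \<and> code_density (F q) n m k d
          \<le> 1 - (real (num_rank_le (F q) n m (d - 1)) - 1)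
                 * ((real q ^ k - 1) / (real q ^ (m * n) - 1))
               / ((real q - 1)
                  + (real (num_rank_le (F q) n m (d - 1)) - real q)
                    * ((real q ^ (k - 1) - 1) / (real q ^ (m * n - 1) - 1))))
   \<and> (\<lambda>q. 1 - code_density (F q) n m k d)
       \<in> O[prime_powers_at_top](\<lambda>q. real q powi
            ((int d - 1) * (int m + int n - int d + 1) - (int (m * n) - int k) - 1))
   \<and> (\<lambda>q. code_density (F q) n m k d)
       \<in> O[prime_powers_at_top](\<lambda>q. real q powi
            (- ((int d - 1) * (int m + int n - int d + 1)) + (int (m * n) - int k) + 1))
   \<and> ((int d - 1) * (int m + int n - int d + 1) \<le> int (m * n) - int k \<longrightarrow>
        ((\<lambda>q. code_density (F q) n m k d) \<longlongrightarrow> 1) prime_powers_at_top)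
   \<and> (int (m * n) - int k + 2 \<le> (int d - 1) * (int m + int n - int d + 1) \<longrightarrow>
        ((\<lambda>q. code_density (F q) n m k d) \<longlongrightarrow> 0) prime_powers_at_top)"
proof -
  define r where "r = d - 1"
  define e where "e = r * (n + m - r)"
  have r: "1 \<le> r" "r + 1 \<le> n" "Suc r = d" using d by (auto simp: r_def)
  have int_e: "(int d - 1) * (int m + int n - int d + 1) = int e"
  proof -
    have "int d = int r + 1" using r(3) by simp
    moreover have "int (n + m - r) = int n + int m - int r" using r mn by (simp add: of_nat_diff)
    ultimately show ?thesis unfolding e_def of_nat_mult by (simp only:) simp
  qed
  \<comment> \<open>The comparison functions of the two asymptotic estimates.\<close>
  define A where "A q = real q powi (int e - (int (m * n) - int k) - 1)" for q :: nat
  define B where "B q = real q powi (- int e + (int (m * n) - int k) + 1)" for q :: nat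
  have A_eq: "A q = real q ^ e * real q ^ k / (real q ^ (m * n) * real q)"
    and B_eq: "B q = real q * real q ^ (m * n) / (real q ^ e * real q ^ k)" if "q \<noteq> 0" for q
    unfolding A_def B_def using that
    by (simp_all add: power_int_diff power_int_add power_int_minus field_simps del: of_nat_mult)

  define c1 where "c1 = 2 * real (m choose r)"
  define c2 :: real where "c2 = 2 ^ (r + 2)"
  have counting: "code_counting (F q) n m k" and card_F: "card (carrier (F q)) = q"
    if "primepow q" for q
  proof -
    show cF: "card (carrier (F q)) = q" using F[OF that] by simp
    have "finite (carrier (F q))" using cF primepow_gt_0_nat[OF that] card_ge_0_finite by metis
    then show "code_counting (F q) n m k"
      using F[OF that] k by (simp add: code_counting_def finite_field_matrices_def code_counting_axioms_def)
  qed
  have exact: "1 - code_density (F q) n m k d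
      \<le> (real (num_rank_le (F q) n m (d - 1)) - 1) * q_binomial q (m * n - 1) (k - 1)
         / ((real q - 1) * q_binomial q (m * n) k)"
    "code_density (F q) n m k d
      \<le> 1 - (real (num_rank_le (F q) n m (d - 1)) - 1)
             * ((real q ^ k - 1) / (real q ^ (m * n) - 1))
           / ((real q - 1)
              + (real (num_rank_le (F q) n m (d - 1)) - real q)
                * ((real q ^ (k - 1) - 1) / (real q ^ (m * n - 1) - 1)))"
    if "primepow q" for q
    using code_counting.one_minus_code_density_le[OF counting[OF that], of r]
      code_counting.code_density_le[OF counting[OF that], of r]
    unfolding card_F[OF that] r_def r(3)[unfolded r_def] .
  have dens: "0 \<le> 1 - code_density (F q) n m k d" "0 \<le> code_density (F q) n m k d"
    "1 - code_density (F q) n m k d \<le> c1 * A q" "code_density (F q) n m k d \<le> c2 * B q"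
    if "primepow q" for q
  proof -
    have q: "q \<noteq> 0" using primepow_gt_0_nat[OF that] by simp
    note cc = counting[OF that]
    show "0 \<le> 1 - code_density (F q) n m k d"
      using code_counting.code_density_le_1[OF cc, of r] r(3) by simp
    show "0 \<le> code_density (F q) n m k d"
      using code_counting.code_density_nonneg[OF cc, of r] r(3) by simp
    show "1 - code_density (F q) n m k d \<le> c1 * A q"
      using code_counting.one_minus_code_density_le_power[OF cc, of r] r mn
      by (simp add: A_eq[OF q] c1_def e_def card_F[OF that])
    show "code_density (F q) n m k d \<le> c2 * B q"
      using code_counting.code_density_le_power[OF cc r(1,2) mn(2)]
      unfolding card_F[OF that] r(3) B_eq[OF q] c2_def e_def .
  qed

  have eventually_primepow: "eventually Q prime_powers_at_top" if "\<And>q. primepow q \<Longrightarrow> Q q" for Q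
    unfolding prime_powers_at_top_def eventually_inf_principal
    by (rule always_eventually) (use that in simp)
  have bigo: "f \<in> O[prime_powers_at_top](g)"
    if "\<And>q. primepow q \<Longrightarrow> 0 \<le> f q \<and> f q \<le> c * g q \<and> 0 \<le> g q" for f g :: "nat \<Rightarrow> real" and c
    by (rule bigoI[of _ c], rule eventually_primepow) (use that in simp)
  have inverse_0: "((\<lambda>q. c / real q) \<longlongrightarrow> 0) prime_powers_at_top" for c :: real
    unfolding prime_powers_at_top_def
    by (rule tendsto_mono[OF inf_le1 lim_const_over_n])
  have to_0: "(f \<longlongrightarrow> 0) prime_powers_at_top"
    if f: "\<And>q. primepow q \<Longrightarrow> 0 \<le> f q \<and> f q \<le> c * real q powi E" and c: "0 \<le> c" and E: "E \<le> -1"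
    for f :: "nat \<Rightarrow> real" and c E
  proof (rule tendsto_sandwich[OF _ _ tendsto_const inverse_0[of c]]; rule eventually_primepow)
    fix q :: nat assume q: "primepow q"
    have "real q powi E \<le> real q powi (-1)"
      using primepow_gt_0_nat[OF q] by (intro power_int_increasing E) auto
    then have "c * real q powi E \<le> c / real q"
      using mult_left_mono[OF _ c] by (simp add: divide_inverse power_int_minus)
    then show "f q \<le> c / real q" using f[OF q] by simp
  qed (use f in simp)
  have c1: "0 \<le> c1" and c2: "0 \<le> c2" by (simp_all add: c1_def c2_def)
  show ?thesis
    unfolding int_e
  proof (intro conjI allI impI)
    show "(\<lambda>q. 1 - code_density (F q) n m k d) \<in> O[prime_powers_at_top](\<lambda>q. real q powi
        (int e - (int (m * n) - int k) - 1))"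
      using dens by (intro bigo[of _ c1]) (auto simp: A_def)
    show "(\<lambda>q. code_density (F q) n m k d) \<in> O[prime_powers_at_top](\<lambda>q. real q powi
        (- int e + (int (m * n) - int k) + 1))"
      using dens by (intro bigo[of _ c2]) (auto simp: B_def)
    show "((\<lambda>q. code_density (F q) n m k d) \<longlongrightarrow> 1) prime_powers_at_top"
      if "int e \<le> int (m * n) - int k"
    proof -
      have "((\<lambda>q. 1 - code_density (F q) n m k d) \<longlongrightarrow> 0) prime_powers_at_top"
        by (rule to_0[OF _ c1]) (use dens that in \<open>auto simp: A_def\<close>)
      from tendsto_diff[OF tendsto_const[of 1] this] show ?thesis by simp
    qed
    show "((\<lambda>q. code_density (F q) n m k d) \<longlongrightarrow> 0) prime_powers_at_top"
      if "int (m * n) - int k + 2 \<le> int e"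
      by (rule to_0[OF _ c2]) (use dens that in \<open>auto simp: B_def\<close>)
  qed (use exact in blast)+
qed

end
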